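(* Let $n\ge 1$ be an integer and let the edges of the complete graph $K_{4n}$ be coloured with two colours (black and red) so that the number of black edges equals the number of red edges. Then $K_{4n}$ has a perfect matching in which the number of black edges equals the number of red edges. *)

theory Defs
  imports Main "HOL-Library.Ramsey"
begin

text \<open>An undirected simple graph is given by a vertex set \<open>V\<close> and a set \<open>E\<close> of two-element
  subsets of \<open>V\<close>; the edge set of the complete graph on \<open>V\<close> is \<open>[V]\<^bsup>2\<^esup>\<close>.\<close>

definition matching :: "'a set set \<Rightarrow> 'a set set \<Rightarrow> bool" where
  "matching E M \<longleftrightarrow> M \<subseteq> E \<and> pairwise disjnt M"

definition perfect_matching :: "'a set \<Rightarrow> 'a set set \<Rightarrow> 'a set set \<Rightarrow> bool" where
  "perfect_matching V E M \<longleftrightarrow> matching E M \<and> (\<forall>v\<in>V. \<exists>e\<in>M. v \<in> e)"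

datatype colour = Black | Red

end

theory Submission
  imports Defs "HOL-Library.Multiset"
begin

text \<open>
  Suppose that no perfect matching has exactly \<open>n\<close> black edges. Averaging gives a matching with more
  and one with fewer than \<open>n\<close> black edges, and any two matchings are linked by switches of two edges,
  so some switch \<open>ab, cd \<rightarrow> ac, bd\<close> jumps from \<open>n + 1\<close> to \<open>n - 1\<close>; the rest \<open>N\<close> of the matching is
  balanced. The third matching \<open>ad, bc\<close> is monochromatic, black up to exchanging the colours.
  Rematching \<open>a, b, c, d\<close> with two edges of \<open>N\<close> can never give \<open>n\<close> black edges; first with a red and
  a black edge of \<open>N\<close>, then with two arbitrary ones, this forces the black edges to form a cut
  \<open>(A, V - A)\<close>. The edge count then reads \<open>|A| (4n - |A|) = n (4n - 1)\<close>, that is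
  \<open>(2n - |A|)\<^sup>2 = n\<close>, so \<open>|A|\<close> and \<open>n\<close> have the same parity. But every perfect matching has
  \<open>|A|\<close> black edges modulo 2, and one has \<open>n + 1\<close>.

  A perfect matching is represented by a multiset \<open>P\<close> of ordered pairs, with arbitrary orientation,
  such that \<open>verts P = mset_set V\<close>.
\<close>

section \<open>Pairings as multisets, and switches between them\<close>

definition verts :: "('a \<times> 'a) multiset \<Rightarrow> 'a multiset" where
  "verts P = (\<Sum>(x, y)\<in>#P. {#x, y#})"

definition cnt :: "('a \<Rightarrow> 'a \<Rightarrow> bool) \<Rightarrow> ('a \<times> 'a) multiset \<Rightarrow> nat" where
  "cnt f P = size {#(x, y) \<in># P. f x y#}"

lemma verts_simps [simp]:
  "verts {#} = {#}"
  "verts (add_mset (x, y) P) = {#x, y#} + verts P"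
  by (simp_all add: verts_def)

lemma cnt_simps [simp]:
  "cnt f {#} = 0"
  "cnt f (add_mset (x, y) P) = of_bool (f x y) + cnt f P"
  by (simp_all add: cnt_def)

lemma size_verts: "size (verts P) = 2 * size P"
  by (induction P) auto

lemma cnt_not: "cnt f P + cnt (\<lambda>x y. \<not> f x y) P = size P"
  by (induction P) auto

text \<open>Reorienting a pair changes neither \<open>verts\<close> nor, by symmetry,
  \<open>cnt f\<close>, so the pair at \<open>p\<close> may be read as starting in \<open>p\<close>.
  The last conclusion keeps the true orientation for arguments about \<open>P\<close> itself rather
  than its counts.\<close>

lemma verts_extract:
  assumes "p \<in># verts P" and "symp f"
  obtains y P' where "verts P = verts (add_mset (p, y) P')"
    "cnt f P = cnt f (add_mset (p, y) P')" "size P = Suc (size P')"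
    "P = add_mset (p, y) P' \<or> P = add_mset (y, p) P'"
proof -
  from assms(1) have "\<exists>y. (p, y) \<in># P \<or> (y, p) \<in># P"
  proof (induction P)
    case (add e P)
    then show ?case by (cases e) (simp, blast)
  qed simp
  then obtain y P' where *: "P = add_mset (p, y) P' \<or> P = add_mset (y, p) P'"
    using multi_member_split[of _ P] by blast
  have "f y p = f p y" using assms(2) by (metis sympD)
  with * show ?thesis
    by (intro that[of y P']) auto
qed

text \<open>One switch suffices to create a prescribed pair \<open>(a, b)\<close>: if
  \<open>a\<close> and \<open>b\<close> have partners \<open>x\<close> and \<open>y\<close>, it
  turns \<open>ax, by\<close> into \<open>ab, xy\<close>. Used in contrapositive form: a property
  that holds at \<open>P\<close> and fails at \<open>P'\<close>, and does not depend on orientation,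
  is destroyed by some single switch.\<close>

lemma switch_induct:
  assumes "S P" and "verts P = verts P'"
    and "\<And>a b c d N. S (add_mset (a, b) (add_mset (c, d) N)) \<Longrightarrow>
                      S (add_mset (a, c) (add_mset (b, d) N))"
    and "\<And>a b N. S (add_mset (a, b) N) \<Longrightarrow> S (add_mset (b, a) N)"
  shows "S P'"
  using assms
proof (induction P' arbitrary: S P)
  case empty
  then have "size (verts P) = 0" by simp
  then have "P = {#}" by (simp add: size_verts)
  with empty show ?case by simp
next
  case (add e P'')
  obtain a b where e: "e = (a, b)" by (cases e)
  note sw = add.prems(3) and fl = add.prems(4)
  have ex: "\<exists>x P1. S (add_mset (a, x) P1 ) \<and> verts (add_mset (a, x) P1) = verts P"
  proof -
    have "a \<in># verts P" using add.prems(2) e by simp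
    then obtain x P1 where "verts P = verts (add_mset (a, x) P1)"
      "P = add_mset (a, x) P1 \<or> P = add_mset (x, a) P1"
      by (rule verts_extract[where f = "\<lambda>_ _. True"]) (auto simp: symp_def)
    then show ?thesis using add.prems(1) fl by metis
  qed
  then obtain x P1 where P1: "S (add_mset (a, x) P1)" "verts (add_mset (a, x) P1) = verts P"
    by blast
  have v1: "add_mset x (verts P1) = add_mset b (verts P'')"
    using P1(2) add.prems(2) e by simp
  have "\<exists>P0. S (add_mset (a, b) P0) \<and> verts P0 = verts P''"
  proof (cases "x = b")
    case True
    then show ?thesis using P1 v1 by auto
  next
    case False
    then have "b \<in># verts P1" using v1
      by (metis insert_noteq_member)
    then obtain y P2 where P2: "verts P1 = verts (add_mset (b, y) P2)"
      "P1 = add_mset (b, y) P2 \<or> P1 = add_mset (y, b) P2"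
      by (rule verts_extract[where f = "\<lambda>_ _. True"]) (auto simp: symp_def)
    have "S (add_mset (a, x) (add_mset (b, y) P2))"
      using P2(2) P1(1) fl[of y b "add_mset (a, x) P2"] by (auto simp: add_mset_commute)
    then have "S (add_mset (a, b) (add_mset (x, y) P2))" by (rule sw)
    moreover have "verts (add_mset (x, y) P2) = verts P''"
      using v1 P2(1) by (simp add: add_mset_commute)
    ultimately show ?thesis by blast
  qed
  then obtain P0 where "S (add_mset (a, b) P0)" "verts P0 = verts P''" by blast
  \<comment> \<open>The pair \<open>(a, b)\<close> stays fixed from here on; it is absorbed into the
    predicate, which is why the induction generalises over \<open>S\<close>.\<close>
  then have "S (add_mset (a, b) P'')"
  proof (rule add.IH[where S = "\<lambda>X. S (add_mset (a, b) X)"], goal_cases)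
    case (1 p q r s N)
    then show ?case
      using sw[of p q r s "add_mset (a, b) N"] by (simp add: add_mset_commute)
  next
    case (2 p q N)
    then show ?case
      using fl[of p q "add_mset (a, b) N"] by (simp add: add_mset_commute)
  qed
  then show ?case using e by simp
qed

section \<open>Averaging over perfect matchings\<close>

text \<open>The sum counts every edge twice. The induction removes a pair \<open>p, q\<close> chosen by averaging
  over all ordered pairs.\<close>

lemma exists_pairing_ge_average:
  fixes f :: "'a \<Rightarrow> 'a \<Rightarrow> bool"
  assumes "symp f" and "finite V" and "card V = 2 * k"
  shows "\<exists>P. verts P = mset_set V \<and>
     (\<Sum>p\<in>V. \<Sum>q\<in>V. of_bool (p \<noteq> q \<and> f p q)) \<le> 2 * (2 * int k - 1) * int (cnt f P)"
  using assms(2,3)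
proof (induction k arbitrary: V)
  case 0
  then show ?case by (intro exI[of _ "{#}"]) auto
next
  case (Suc k)
  define w :: "'a \<Rightarrow> 'a \<Rightarrow> int" where "w p q = of_bool (p \<noteq> q \<and> f p q)" for p q
  have sym: "w p q = w q p" for p q using assms(1) by (auto simp: w_def symp_def)
  have w0 [simp]: "w p p = 0" for p by (simp add: w_def)
  define D where "D W = (\<Sum>p\<in>W. \<Sum>q\<in>W. w p q)" for W
  define d where "d p = (\<Sum>q\<in>V. w p q)" for p
  have fin [simp]: "finite V" by fact
  have d': "(\<Sum>q\<in>V. w q p) = d p" for p by (simp add: d_def sym)
  have D_remove: "D (V - {p, q}) = D V - 2 * d p - 2 * d q + 2 * w p q"
    if "p \<in> V" "q \<in> V" "p \<noteq> q" for p q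
  proof -
    have sub: "(\<Sum>r\<in>V - {p, q}. g r) = (\<Sum>r\<in>V. g r) - g p - g q" for g :: "'a \<Rightarrow> int"
      using that by (simp add: sum_diff)
    show ?thesis unfolding D_def
      by (simp add: sub sum_subtractf d' flip: d_def) (simp add: sym)
  qed
  \<comment> \<open>The averaging step cancels the factor \<open>2 * k - 1\<close>, which is
    positive only for \<open>k\<close> at least 1; two vertices are therefore treated
    directly.\<close>
  show ?case
  proof (cases "k = 0")
    case True
    then obtain p q where pq: "V = {p, q}" "p \<noteq> q"
      using Suc.prems(2) by (auto simp: card_2_iff numeral_2_eq_2 card_Suc_eq)
    then show ?thesis using True assms(1)
      by (intro exI[of _ "{#(p, q)#}"]) (auto simp: symp_def)
  next
    case False
    define K where "K = int k"
    have K: "K \<ge> 1" using False by (simp add: K_def)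
    have cV: "int (card V) = 2 * K + 2" using Suc.prems(2) by (simp add: K_def)
    \<comment> \<open>Bounding \<open>D (V - {p, q})\<close> by the induction hypothesis and
      cancelling \<open>2 * K - 1\<close> turns this into the claim. Such a pair exists because both
      sides have the same average over all ordered pairs of distinct vertices.\<close>
    have "\<exists>p\<in>V. \<exists>q\<in>V. p \<noteq> q \<and>
      (2 * K - 1) * D V \<le> (2 * K + 1) * (2 * (2 * K - 1) * w p q + D (V - {p, q}))"
    proof (rule ccontr)
      \<comment> \<open>The right-hand side with \<open>D (V - {p, q})\<close> expanded by
        \<open>D_remove\<close>. The formula also makes sense for \<open>p = q\<close>, so the sum
        over distinct pairs is the full double sum minus the diagonal.\<close>
      define g where
        "g p q = (2 * K + 1) * (2 * (2 * K - 1) * w p q + (D V - 2 * d p - 2 * d q + 2 * w p q))" for p q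
      define Y where "Y = (2 * K - 1) * D V"
      assume "\<not> ?thesis"
      then have less: "g p q < Y" if "p \<in> V" "q \<in> V" "p \<noteq> q" for p q
        using that D_remove[of p q] by (force simp: g_def Y_def)
      have "V \<noteq> {}" using cV K by auto
      have "(\<Sum>p\<in>V. \<Sum>q\<in>V - {p}. g p q) < (\<Sum>p\<in>V. \<Sum>q\<in>V - {p}. Y)"
      proof (rule sum_strict_mono)
        fix p assume p: "p \<in> V"
        have "card (V - {p}) \<noteq> 0" using p Suc.prems(2) by simp
        then have "V - {p} \<noteq> {}" by (metis card.empty)
        then show "(\<Sum>q\<in>V - {p}. g p q) < (\<Sum>q\<in>V - {p}. Y)"
          by (intro sum_strict_mono) (use less p in auto)
      qed (use \<open>V \<noteq> {}\<close> in auto)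
      also have "(\<Sum>p\<in>V. \<Sum>q\<in>V - {p}. Y) = (\<Sum>p\<in>V. (2 * K + 1) * Y)"
      proof (rule sum.cong[OF refl])
        fix p assume "p \<in> V"
        then show "(\<Sum>q\<in>V - {p}. Y) = (2 * K + 1) * Y"
          using Suc.prems(2) by (simp add: K_def)
      qed
      also have "\<dots> = (2 * K + 2) * (2 * K + 1) * Y" by (simp add: cV)
      finally have lt: "(\<Sum>p\<in>V. \<Sum>q\<in>V - {p}. g p q) < (2 * K + 2) * (2 * K + 1) * Y" .
      have sd: "(\<Sum>p\<in>V. d p) = D V" by (simp add: d_def D_def)
      have "(\<Sum>p\<in>V. \<Sum>q\<in>V - {p}. g p q) = (\<Sum>p\<in>V. (\<Sum>q\<in>V. g p q) - g p p)"
        by (intro sum.cong) (auto simp: sum_diff1)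
      also have "\<dots> = (\<Sum>p\<in>V. \<Sum>q\<in>V. g p q) - (\<Sum>p\<in>V. g p p)"
        by (simp add: sum_subtractf)
      also have "(\<Sum>p\<in>V. g p p) = (2 * K + 1) * ((2 * K + 2) * D V - 4 * D V)"
        by (simp add: g_def sum_subtractf cV sd flip: sum_distrib_left)
      also have "(\<Sum>p\<in>V. \<Sum>q\<in>V. g p q) = (2 * K + 1) * (2 * (2 * K - 1) * D V +
          ((2 * K + 2) * ((2 * K + 2) * D V - 2 * D V) - (2 * K + 2) * (2 * D V) + 2 * D V))"
        by (simp add: g_def sum_subtractf sum.distrib cV sd flip: sum_distrib_left d_def)
      finally have "(\<Sum>p\<in>V. \<Sum>q\<in>V - {p}. g p q) = (2 * K + 2) * (2 * K + 1) * Y"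
        by (simp add: Y_def algebra_simps)
      with lt show False by simp
    qed
    then obtain p q where pq: "p \<in> V" "q \<in> V" "p \<noteq> q"
      and ge: "(2 * K - 1) * D V \<le> (2 * K + 1) * (2 * (2 * K - 1) * w p q + D (V - {p, q}))"
      by blast
    have "card (V - {p, q}) = 2 * k" using pq Suc.prems(2) by simp
    then obtain P where P: "verts P = mset_set (V - {p, q})"
      "D (V - {p, q}) \<le> 2 * (2 * K - 1) * int (cnt f P)"
      using Suc.IH[of "V - {p, q}"] unfolding D_def w_def K_def by auto
    have V: "mset_set V = {#p, q#} + mset_set (V - {p, q})"
    proof -
      have "mset_set (insert p (insert q (V - {p, q}))) = {#p, q#} + mset_set (V - {p, q})"
        using pq(3) by (simp del: insert_Diff_single)
      moreover have "insert p (insert q (V - {p, q})) = V" using pq by auto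
      ultimately show ?thesis by simp
    qed
    have "(2 * K - 1) * D V \<le> (2 * K + 1) * (2 * (2 * K - 1) * w p q + 2 * (2 * K - 1) * int (cnt f P))"
      using ge P(2) K by (smt (verit, best) mult_left_mono)
    also have "\<dots> = (2 * K - 1) * (2 * (2 * K + 1) * (w p q + int (cnt f P)))"
      by (simp add: algebra_simps)
    finally have "D V \<le> 2 * (2 * K + 1) * (w p q + int (cnt f P))"
      using K by simp
    then show ?thesis
      using V P(1) pq(3)
      by (intro exI[of _ "add_mset (p, q) P"]) (simp add: D_def w_def K_def algebra_simps)
  qed
qed


section \<open>Rematching a black 4-cycle with edges of the balanced rest\<close>

text \<open>The forbidden outcome when the 4-cycle is rematched with one red and one black edge of
  \<open>N\<close>: the remaining edges of \<open>N\<close> contain \<open>n - 2\<close> black ones,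
  so two more would give \<open>n\<close>.\<close>

definition exactly_two :: "bool \<Rightarrow> bool \<Rightarrow> bool \<Rightarrow> bool \<Rightarrow> bool" where
  "exactly_two P Q R S \<longleftrightarrow> of_bool P + of_bool Q + of_bool R + of_bool S = (2 :: nat)"

lemma exactly_two_iff:
  "exactly_two P Q R S \<longleftrightarrow>
     (if P then if Q then \<not> R \<and> \<not> S else R \<noteq> S else if Q then R \<noteq> S else R \<and> S)"
  by (cases P; cases Q; cases R; cases S) (simp_all add: exactly_two_def)

text \<open>The vertex \<open>p\<close> sees the black 4-cycle \<open>a b c d\<close> like a vertex of a black cut separating
  \<open>a, c\<close> from \<open>b, d\<close>.\<close>

definition fits :: "('a \<Rightarrow> 'a \<Rightarrow> bool) \<Rightarrow> 'a \<Rightarrow> 'a \<Rightarrow> 'a \<Rightarrow> 'a \<Rightarrow> 'a \<Rightarrow> bool" where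
  "fits f a b c d p \<longleftrightarrow> f c p = f a p \<and> f b p = (\<not> f a p) \<and> f d p = (\<not> f a p)"

text \<open>Each instance of \<open>H\<close> is one rematching. For the red \<open>xy\<close>, keep
  \<open>wz\<close> and join \<open>x, y\<close> to the ends of a diagonal (\<open>e1\<close> to
  \<open>e4\<close>) or of a side (\<open>e5\<close> to \<open>e12\<close>) of the cycle, matching
  the other two cycle vertices together. The exceptional patterns that survive are removed in
  \<open>e13\<close> to \<open>e16\<close> by also breaking up \<open>wz\<close>. For the black
  \<open>wz\<close>, the same is done with \<open>xy\<close> kept, and only the all-red pattern
  survives until \<open>e27\<close>.\<close>

lemma fits_of_red_black:
  assumes H: "\<And>p q r s t u v w'. {#p, q, r, s, t, u, v, w'#} = {#a, b, c, d, x, y, w, z#} \<Longrightarrow>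
      \<not> exactly_two (f p q) (f r s) (f t u) (f v w')"
    and Q: "f a b" "f b c" "f c d" "f a d" "\<not> f a c" "\<not> f b d"
    and xy: "\<not> f x y" and wz: "f w z"
  shows "fits f a b c d x \<and> fits f a b c d y \<and> f a x = f a y"
    and "fits f a b c d w \<and> fits f a b c d z \<and> f a w = (\<not> f a z)"
proof -
  have e1: "f a x = f c y"
    using H[of a x c y b d w z] Q xy wz
    by (simp add: exactly_two_iff add_mset_commute split: if_splits)
  have e2: "f c x = f a y"
    using H[of c x a y b d w z] Q xy wz
    by (simp add: exactly_two_iff add_mset_commute split: if_splits)
  have e3: "f b x = f d y"
    using H[of b x d y a c w z] Q xy wz
    by (simp add: exactly_two_iff add_mset_commute split: if_splits)
  have e4: "f d x = f b y"
    using H[of d x b y a c w z] Q xy wz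
    by (simp add: exactly_two_iff add_mset_commute split: if_splits)
  have e5: "f a x \<or> f b y"
    using H[of a x b y c d w z] Q xy wz
    by (simp add: exactly_two_iff add_mset_commute split: if_splits)
  have e6: "f b x \<or> f a y"
    using H[of b x a y c d w z] Q xy wz
    by (simp add: exactly_two_iff add_mset_commute split: if_splits)
  have e7: "f b x \<or> f c y"
    using H[of b x c y a d w z] Q xy wz
    by (simp add: exactly_two_iff add_mset_commute split: if_splits)
  have e8: "f c x \<or> f b y"
    using H[of c x b y a d w z] Q xy wz
    by (simp add: exactly_two_iff add_mset_commute split: if_splits)
  have e9: "f c x \<or> f d y"
    using H[of c x d y a b w z] Q xy wz
    by (simp add: exactly_two_iff add_mset_commute split: if_splits)
  have e10: "f d x \<or> f c y"
    using H[of d x c y a b w z] Q xy wz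
    by (simp add: exactly_two_iff add_mset_commute split: if_splits)
  have e11: "f a x \<or> f d y"
    using H[of a x d y b c w z] Q xy wz
    by (simp add: exactly_two_iff add_mset_commute split: if_splits)
  have e12: "f d x \<or> f a y"
    using H[of d x a y b c w z] Q xy wz
    by (simp add: exactly_two_iff add_mset_commute split: if_splits)
  \<comment> \<open>Up to symmetry, the only other ways to join a red \<open>xy\<close> to the 4-cycle have all of the
    following edges black.\<close>
  have e13: "\<not> (f b x \<and> f d x \<and> f b y \<and> f d y \<and> f a y \<and> f c x)"
    using H[of a z w y b d c x]
      H[of a z w y b c d x]
      H[of x z c w b d a y]
      H[of x z c w a b d y]
      H[of a z c w b d x y] Q xy wz
    by (simp add: exactly_two_iff add_mset_commute split: if_splits)
  have e14: "\<not> (f b y \<and> f d y \<and> f b x \<and> f d x \<and> f a x \<and> f c y)"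
    using H[of a z w x b d c y]
      H[of a z w x b c d y]
      H[of y z c w b d a x]
      H[of y z c w a b d x]
      H[of a z c w b d x y] Q xy wz
    by (simp add: exactly_two_iff add_mset_commute split: if_splits)
  have e15: "\<not> (f a x \<and> f c x \<and> f a y \<and> f c y \<and> f b y \<and> f d x)"
    using H[of b z w y a c d x]
      H[of b z w y a d c x]
      H[of x z d w a c b y]
      H[of x z d w a b c y]
      H[of b z d w a c x y] Q xy wz
    by (simp add: exactly_two_iff add_mset_commute split: if_splits)
  have e16: "\<not> (f a y \<and> f c y \<and> f a x \<and> f c x \<and> f b x \<and> f d y)"
    using H[of b z w x a c d y]
      H[of b z w x a d c y]
      H[of y z d w a c b x]
      H[of y z d w a b c x]
      H[of b z d w a c x y] Q xy wz
    by (simp add: exactly_two_iff add_mset_commute split: if_splits)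
  show "fits f a b c d x \<and> fits f a b c d y \<and> f a x = f a y"
    using e1 e2 e3 e4 e5 e6 e7 e8 e9 e10 e11 e12 e13 e14 e15 e16
    unfolding fits_def by blast
  have e17: "f a w = f b z"
    using H[of a w b z c d x y] Q xy wz
    by (simp add: exactly_two_iff add_mset_commute split: if_splits)
  have e18: "f b w = f a z"
    using H[of b w a z c d x y] Q xy wz
    by (simp add: exactly_two_iff add_mset_commute split: if_splits)
  have e19: "f b w = f c z"
    using H[of b w c z a d x y] Q xy wz
    by (simp add: exactly_two_iff add_mset_commute split: if_splits)
  have e20: "f c w = f b z"
    using H[of c w b z a d x y] Q xy wz
    by (simp add: exactly_two_iff add_mset_commute split: if_splits)
  have e21: "f c w = f d z"
    using H[of c w d z a b x y] Q xy wz
    by (simp add: exactly_two_iff add_mset_commute split: if_splits)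
  have e22: "f d w = f c z"
    using H[of d w c z a b x y] Q xy wz
    by (simp add: exactly_two_iff add_mset_commute split: if_splits)
  have e23: "f a w = f d z"
    using H[of a w d z b c x y] Q xy wz
    by (simp add: exactly_two_iff add_mset_commute split: if_splits)
  have e24: "f d w = f a z"
    using H[of d w a z b c x y] Q xy wz
    by (simp add: exactly_two_iff add_mset_commute split: if_splits)
  have e25: "\<not> (f a w \<and> f c z)"
    using H[of a w c z b d x y] Q xy wz
    by (simp add: exactly_two_iff add_mset_commute split: if_splits)
  have e26: "\<not> (f c w \<and> f a z)"
    using H[of c w a z b d x y] Q xy wz
    by (simp add: exactly_two_iff add_mset_commute split: if_splits)
  \<comment> \<open>If all edges from \<open>w, z\<close> to the cycle were red, then
    \<open>ax, cy\<close> would have equal colours and not both be black beside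
    \<open>bz, dw\<close>, hence both be red; likewise \<open>dx, by\<close>. Then
    \<open>ax, by, cd, wz\<close> has exactly two black edges.\<close>
  have e27: "\<not> (\<not> f a w \<and> \<not> f b w \<and> \<not> f c w \<and> \<not> f d w \<and> \<not> f a z \<and> \<not> f b z \<and> \<not> f c z \<and> \<not> f d z)"
    using H[of a x c y b d w z]
      H[of a x c y b z d w]
      H[of d x b y a c w z]
      H[of d x b y a z c w]
      H[of a x b y c d w z] Q xy wz
    by (auto simp: exactly_two_iff add_mset_commute split: if_splits)
  show "fits f a b c d w \<and> fits f a b c d z \<and> f a w = (\<not> f a z)"
    using e17 e18 e19 e20 e21 e22 e23 e24 e25 e26 e27
    unfolding fits_def by blast
qed

text \<open>Matching \<open>w\<close> with \<open>x\<close> leaves \<open>y\<close> and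
  \<open>z\<close> to be joined to two cycle vertices while the other two are matched together; all
  these colours are known. If \<open>wx\<close> had the wrong colour, one of the four rematchings
  used would reach the forbidden count.\<close>

lemma cross_edge_of_fits:
  assumes H: "\<And>p q r s t u v w'. {#p, q, r, s, t, u, v, w'#} = {#a, b, c, d, x, y, w, z#} \<Longrightarrow>
      of_bool (f p q) + of_bool (f r s) + of_bool (f t u) + of_bool (f v w') \<noteq>
      1 + of_bool (f a x \<noteq> f a y) + (of_bool (f a w \<noteq> f a z) :: nat)"
    and Q: "f a b" "f b c" "f c d" "f a d" "\<not> f a c" "\<not> f b d"
    and "fits f a b c d y" "fits f a b c d z"
  shows "f w x = (f a w \<noteq> f a x)"
  using H[of w x a y b z c d] H[of w x a y c z b d] H[of w x b y d z a c] H[of w x b y a z c d] Q assms(8-)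
  unfolding fits_def
  by (cases "f w x"; cases "f a x"; cases "f a y"; cases "f a w"; cases "f a z") simp_all

lemma cnt_pos_extract:
  assumes "cnt g P > 0"
  obtains x y P' where "P = add_mset (x, y) P'" "g x y"
proof -
  from assms have "{#(x, y) \<in># P. g x y#} \<noteq> {#}"
    by (metis cnt_def less_irrefl size_empty)
  then obtain e where "e \<in># {#(x, y) \<in># P. g x y#}" by (meson multiset_nonemptyE)
  then have "e \<in># P" "g (fst e) (snd e)" by auto
  then show ?thesis using that by (metis multi_member_split prod.collapse)
qed

text \<open>Here \<open>k\<close> stands for \<open>n - 1\<close>, and \<open>f\<close> may be
  either colour. First every vertex of \<open>N\<close> is shown to fit the 4-cycle, then edges
  between different pairs of \<open>N\<close> are determined.\<close>

lemma cut_of_unbalanced_quad: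
  fixes f :: "'a \<Rightarrow> 'a \<Rightarrow> bool"
  assumes "symp f" and Q: "f a b" "f b c" "f c d" "f a d" "\<not> f a c" "\<not> f b d"
    and V: "mset_set V = {#a, b, c, d#} + verts N"
    and cntN: "cnt f N = k" and sizeN: "size N = 2 * k"
    and none: "\<And>P. verts P = mset_set V \<Longrightarrow> cnt f P \<noteq> Suc k"
  shows "\<exists>l. \<forall>p\<in>V. \<forall>q\<in>V. p \<noteq> q \<longrightarrow> f p q = (l p \<noteq> (l q :: bool))"
proof -
  have fs: "f p q = f q p" for p q using assms(1) by (metis sympD)
  have avoid: "of_bool (f p q) + of_bool (f r s) + of_bool (f t u) + of_bool (f v w') \<noteq>
      1 + of_bool (f x y) + (of_bool (f w z) :: nat)"
    if N': "verts N = {#x, y, w, z#} + verts N'"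
       "k = of_bool (f x y) + of_bool (f w z) + cnt f N'"
      and eq: "{#p, q, r, s, t, u, v, w'#} = {#a, b, c, d, x, y, w, z#}"
    for p q r s t u v w' x y w z N'
  proof -
    let ?P = "add_mset (p, q) (add_mset (r, s) (add_mset (t, u) (add_mset (v, w') N')))"
    have "verts ?P = {#p, q, r, s, t, u, v, w'#} + verts N'"
      by (simp add: add_mset_commute)
    also have "\<dots> = mset_set V"
      unfolding eq using V N'(1) by (simp add: add_mset_commute)
    finally have "cnt f ?P \<noteq> Suc k" by (rule none)
    then show ?thesis using N'(2) by simp
  qed
  have fits: "fits f a b c d x \<and> fits f a b c d y \<and> f x y = (f a x \<noteq> f a y)"
    if N': "verts N = {#x, y#} + verts N'" "k = of_bool (f x y) + cnt f N'"
      "Suc (size N') = 2 * k"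
    for x y N'
  proof (cases "f x y")
    case True
    \<comment> \<open>Since \<open>N\<close> is balanced, every edge of it has a companion of the
      other colour, as \<open>fits_of_red_black\<close> requires.\<close>
    have "cnt (\<lambda>x y. \<not> f x y) N' > 0"
      using cnt_not[of f N'] N'(2,3) True by simp
    then obtain r s N'' where N'': "N' = add_mset (r, s) N''" "\<not> f r s"
      by (rule cnt_pos_extract)
    have "fits f a b c d x \<and> fits f a b c d y \<and> f a x = (\<not> f a y)"
    proof (rule fits_of_red_black(2)[of a b c d r s x y f, OF _ Q N''(2) True])
      fix p q r' s' t u v w'
      assume "{#p, q, r', s', t, u, v, w'#} = {#a, b, c, d, r, s, x, y#}"
      from avoid[OF _ _ this, of N''] show "\<not> exactly_two (f p q) (f r' s') (f t u) (f v w')"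
        using N' N'' True by (simp add: exactly_two_def add_mset_commute)
    qed
    then show ?thesis using True by auto
  next
    case False
    have "cnt f N' > 0"
      using N'(2,3) False by simp
    then obtain r s N'' where N'': "N' = add_mset (r, s) N''" "f r s"
      by (rule cnt_pos_extract)
    have "fits f a b c d x \<and> fits f a b c d y \<and> f a x = f a y"
    proof (rule fits_of_red_black(1)[of a b c d x y r s f, OF _ Q False N''(2)])
      fix p q r' s' t u v w'
      assume "{#p, q, r', s', t, u, v, w'#} = {#a, b, c, d, x, y, r, s#}"
      from avoid[OF _ _ this, of N''] show "\<not> exactly_two (f p q) (f r' s') (f t u) (f v w')"
        using N' N'' False by (simp add: exactly_two_def add_mset_commute)
    qed
    then show ?thesis using False by auto
  qed
  have fitsN: "fits f a b c d p" if "p \<in># verts N" for p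
    using that assms(1)
  proof (rule verts_extract)
    fix y P' assume "verts N = verts (add_mset (p, y) P')"
      "cnt f N = cnt f (add_mset (p, y) P')" "size N = Suc (size P')"
    then show ?thesis using fits[of p y P'] cntN sizeN by simp
  qed
  have NN: "f p q = (f a p \<noteq> f a q)" if pq: "p \<in># verts N" "q \<in># verts N" "p \<noteq> q" for p q
  proof -
    obtain y N' where N': "verts N = verts (add_mset (p, y) N')"
      "cnt f N = cnt f (add_mset (p, y) N')" "size N = Suc (size N')"
      using verts_extract[OF pq(1) assms(1)] by metis
    have py: "fits f a b c d y" "f p y = (f a p \<noteq> f a y)"
      using fits[of p y N'] N' cntN sizeN by simp_all
    show ?thesis
    \<comment> \<open>Either \<open>pq\<close> can itself be taken as a pair of the matching, or
      \<open>p\<close> and \<open>q\<close> lie in two separate pairs \<open>py\<close> and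
      \<open>qz\<close>.\<close>
    proof (cases "q = y")
      case True
      then show ?thesis using py by simp
    next
      case False
      then have "q \<in># verts N'" using N'(1) pq by auto
      then obtain z N'' where N'': "verts N' = verts (add_mset (q, z) N'')"
        "cnt f N' = cnt f (add_mset (q, z) N'')" "size N' = Suc (size N'')"
        using verts_extract[OF _ assms(1)] by metis
      have qz: "fits f a b c d z" "f q z = (f a q \<noteq> f a z)"
        using fits[of q z "add_mset (p, y) N''"] N' N'' cntN sizeN
        by (simp_all add: add_mset_commute)
      have "f q p = (f a q \<noteq> f a p)"
      proof (rule cross_edge_of_fits[of a b c d p y q z f, OF _ Q py(1) qz(1)])
        fix p' q' r s t u v w'
        assume "{#p', q', r, s, t, u, v, w'#} = {#a, b, c, d, p, y, q, z#}"
        from avoid[OF _ _ this, of N'']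
        show "of_bool (f p' q') + of_bool (f r s) + of_bool (f t u) + of_bool (f v w') \<noteq>
          1 + of_bool (f a p \<noteq> f a y) + (of_bool (f a q \<noteq> f a z) :: nat)"
          using N' N'' cntN py(2) qz(2) by (simp add: add_mset_commute)
      qed
      then show ?thesis using fs[of p q] by auto
    qed
  qed
  \<comment> \<open>\<open>mset_set\<close> of an infinite set is empty by convention, so a nonempty
    value forces finiteness.\<close>
  have "finite V" using V by (metis add_mset_not_empty mset_set.infinite union_mset_add_mset_left)
  then have inV: "p \<in> V \<longleftrightarrow> p \<in> {a, b, c, d} \<or> p \<in># verts N" for p
    using arg_cong[OF V, of "\<lambda>X. p \<in># X"] by simp
  have "count (mset_set V) a \<le> 1" by (simp add: count_mset_set')
  then have a: "b \<noteq> a" "c \<noteq> a" "d \<noteq> a" "a \<notin># verts N"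
    unfolding V by (auto split: if_splits simp: count_eq_zero_iff)
  \<comment> \<open>The side of the cut not containing \<open>a\<close>. The value at
    \<open>a\<close> is set explicitly because nothing is known about \<open>f a a\<close>.\<close>
  define l where "l p \<longleftrightarrow> p \<noteq> a \<and> f a p" for p
  have lQ: "\<not> l a" "l b" "\<not> l c" "l d" using Q a by (auto simp: l_def)
  have lN: "f a p = l p" "f b p = (\<not> l p)" "f c p = l p" "f d p = (\<not> l p)"
    if "p \<in># verts N" for p
    using fitsN[OF that] a that by (auto simp: fits_def l_def)
  have "f p q = (l p \<noteq> l q)" if "p \<in> V" "q \<in> V" "p \<noteq> q" for p q
  proof -
    have QN: "f p q = (l p \<noteq> l q)" if "p \<in> {a, b, c, d}" "q \<in># verts N" for p q
      using that lQ lN[of q] by auto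
    have QQ: "f p q = (l p \<noteq> l q)" if "p \<in> {a, b, c, d}" "q \<in> {a, b, c, d}" "p \<noteq> q" for p q
      using that lQ Q fs[of p q] by auto
    show ?thesis
      using that QN[of p q] QN[of q p] QQ[of p q] NN[of p q] lN(1)[of p] lN(1)[of q] fs[of p q]
      unfolding inV by metis
  qed
  then show ?thesis by blast
qed

section \<open>Edge counts and parity of cuts\<close>

text \<open>Links the double sums of the averaging bound to edge sets. A new vertex \<open>v\<close>
  contributes its star twice, once in each order.\<close>

lemma sum_ordered_pairs_eq_card_edges:
  assumes "finite V"
  shows "(\<Sum>p\<in>V. \<Sum>q\<in>V. of_bool (p \<noteq> q \<and> R {p, q})) = 2 * int (card {e \<in> [V]\<^bsup>2\<^esup>. R e})"
  using assms
proof (induction V)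
  case empty
  then show ?case by (simp add: nsets_def)
next
  case (insert v V)
  have "{e \<in> [insert v V]\<^bsup>2\<^esup>. R e} = {e \<in> [V]\<^bsup>2\<^esup>. R e} \<union> (\<lambda>q. {v, q}) ` {q \<in> V. R {v, q}}"
    (is "?L = ?R")
  proof (intro equalityI subsetI)
    fix e assume "e \<in> ?L"
    then obtain x y where e: "e = {x, y}" "x \<noteq> y" "x \<in> insert v V" "y \<in> insert v V" "R e"
      by (auto simp: nsets_def card_2_iff)
    consider "x = v" "y \<in> V" | "y = v" "x \<in> V" "e = {y, x}" | "x \<in> V" "y \<in> V"
      using e by auto
    then show "e \<in> ?R" using e by cases (auto simp: nsets_def)
  next
    fix e assume "e \<in> ?R"
    then show "e \<in> ?L" using insert.hyps by (auto simp: nsets_def card_insert_if)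
  qed
  moreover have "{e \<in> [V]\<^bsup>2\<^esup>. R e} \<inter> (\<lambda>q. {v, q}) ` {q \<in> V. R {v, q}} = {}"
    using insert.hyps by (auto simp: nsets_def)
  moreover have "inj_on (\<lambda>q. {v, q}) {q \<in> V. R {v, q}}"
    by (auto simp: inj_on_def doubleton_eq_iff)
  ultimately have card: "card {e \<in> [insert v V]\<^bsup>2\<^esup>. R e} = card {e \<in> [V]\<^bsup>2\<^esup>. R e} + card {q \<in> V. R {v, q}}"
    using insert.hyps by (simp add: card_Un_disjoint card_image finite_imp_finite_nsets)
  have star: "(\<Sum>q\<in>V. of_bool (v \<noteq> q \<and> R {v, q})) = int (card {q \<in> V. R {v, q}})"
    "(\<Sum>q\<in>V. of_bool (q \<noteq> v \<and> R {q, v})) = int (card {q \<in> V. R {v, q}})"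
  proof -
    have "(\<Sum>q\<in>V. of_bool (v \<noteq> q \<and> R {v, q})) = (\<Sum>q\<in>V. of_bool (R {v, q}) :: int)"
      by (intro sum.cong) (use insert.hyps in auto)
    also have "\<dots> = int (card {q \<in> V. R {v, q}})"
      using insert.hyps by (simp add: Int_def)
    finally show "(\<Sum>q\<in>V. of_bool (v \<noteq> q \<and> R {v, q})) = int (card {q \<in> V. R {v, q}})" .
    then show "(\<Sum>q\<in>V. of_bool (q \<noteq> v \<and> R {q, v})) = int (card {q \<in> V. R {v, q}})"
      by (simp add: insert_commute eq_commute)
  qed
  show ?case
    using insert.hyps insert.IH by (simp add: sum.distrib card star del: sum_of_bool_eq)
qed

text \<open>Each vertex contributes the size of the side opposite to its own.\<close>

lemma sum_cut_pairs:
  assumes "finite V"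
  shows "(\<Sum>p\<in>V. \<Sum>q\<in>V. of_bool (p \<noteq> q \<and> l p \<noteq> l q)) =
    2 * int (card {p \<in> V. l p}) * (int (card V) - int (card {p \<in> V. l p}))"
proof -
  define \<alpha> where "\<alpha> = card {p \<in> V. l p}"
  have card: "int (card {q \<in> V. \<not> l q}) = int (card V) - int \<alpha>"
  proof -
    have "card V = card ({q \<in> V. l q} \<union> {q \<in> V. \<not> l q})" by (rule arg_cong) auto
    then show ?thesis using assms by (subst (asm) card_Un_disjoint) (auto simp: \<alpha>_def)
  qed
  have "(\<Sum>q\<in>V. of_bool (p \<noteq> q \<and> l p \<noteq> l q)) = (if l p then int (card V) - int \<alpha> else int \<alpha>)" for p
  proof -
    have "(\<Sum>q\<in>V. of_bool (p \<noteq> q \<and> l p \<noteq> l q)) = int (card {q \<in> V. l q \<noteq> l p})"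
      using assms by (auto intro!: arg_cong[where f = card])
    then show ?thesis by (auto simp: card \<alpha>_def)
  qed
  then have "(\<Sum>p\<in>V. \<Sum>q\<in>V. of_bool (p \<noteq> q \<and> l p \<noteq> l q)) =
      (\<Sum>p\<in>V. if l p then int (card V) - int \<alpha> else int \<alpha>)" by simp
  also have "\<dots> = int \<alpha> * (int (card V) - int \<alpha>) + int (card {q \<in> V. \<not> l q}) * int \<alpha>"
    using assms by (simp add: sum.If_cases \<alpha>_def Int_def Compl_eq)
  finally show ?thesis unfolding card by (simp add: algebra_simps flip: \<alpha>_def)
qed

lemma pairing_edge:
  assumes "verts P = mset_set V" and "(x, y) \<in># P"
  shows "x \<in> V \<and> y \<in> V \<and> x \<noteq> y"
proof -
  obtain P' where "P = add_mset (x, y) P'" using assms(2) by (meson mset_add)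
  then have V: "mset_set V = {#x, y#} + verts P'" using assms(1) by simp
  then have "finite V" by (metis add_mset_not_empty mset_set.infinite union_mset_add_mset_left)
  then have "x \<in> V" "y \<in> V"
    using arg_cong[OF V, of "\<lambda>X. x \<in># X"] arg_cong[OF V, of "\<lambda>X. y \<in># X"] by simp_all
  moreover have "count (mset_set V) x \<le> 1" by (simp add: count_mset_set')
  then have "x \<noteq> y" unfolding V by auto
  ultimately show ?thesis by blast
qed

text \<open>A pair crossing the cut has one endpoint satisfying \<open>l\<close>; any other pair has
  none or two.\<close>

lemma even_cnt_cut:
  "even (cnt (\<lambda>x y. l x \<noteq> l y) P + size (filter_mset l (verts P)))"
proof (induction P)
  case (add e P)
  obtain x y where "e = (x, y)" by (cases e)
  then show ?case using add by (cases "l x"; cases "l y") simp_all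
qed simp

text \<open>Hypothesis \<open>bal\<close> says that \<open>g\<close> holds on half of the edges,
  each counted in both orders. It fixes the parity of the side \<open>l\<close>, and this is the
  parity of every count by \<open>even_cnt_cut\<close>.\<close>

lemma balanced_cut_cnt:
  fixes l :: "'a \<Rightarrow> bool"
  assumes "finite V" and "card V = 4 * n"
    and cut: "\<And>p q. p \<in> V \<Longrightarrow> q \<in> V \<Longrightarrow> p \<noteq> q \<Longrightarrow> g p q = (l p \<noteq> l q)"
    and bal: "(\<Sum>p\<in>V. \<Sum>q\<in>V. of_bool (p \<noteq> q \<and> g p q)) = 2 * int n * (4 * int n - 1)"
    and P: "verts P = mset_set V"
  shows "even (cnt g P) \<longleftrightarrow> even n"
proof -
  define \<alpha> where "\<alpha> = card {p \<in> V. l p}"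
  have "cnt g P = cnt (\<lambda>x y. l x \<noteq> l y) P"
    unfolding cnt_def using pairing_edge[OF P] cut
    by (intro arg_cong[where f = size] filter_mset_cong) auto
  moreover have "size (filter_mset l (verts P)) = \<alpha>"
    by (simp add: P \<alpha>_def filter_mset_mset_set assms(1))
  ultimately have "even (cnt g P + \<alpha>)" using even_cnt_cut[of l P] by simp
  moreover have "(2 * int n - int \<alpha>)\<^sup>2 = int n"
  proof -
    have "(\<Sum>p\<in>V. \<Sum>q\<in>V. of_bool (p \<noteq> q \<and> g p q)) = (\<Sum>p\<in>V. \<Sum>q\<in>V. of_bool (p \<noteq> q \<and> l p \<noteq> l q) :: int)"
      by (intro sum.cong refl) (auto simp: cut)
    then have "2 * int \<alpha> * (4 * int n - int \<alpha>) = 2 * int n * (4 * int n - 1)"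
      using bal sum_cut_pairs[OF assms(1), of l] assms(2) by (simp add: \<alpha>_def)
    then show ?thesis by (simp add: power2_eq_square algebra_simps)
  qed
  then have "even (2 * int n - int \<alpha>) \<longleftrightarrow> even n"
    by (metis even_of_nat even_power zero_less_numeral)
  then have "even \<alpha> \<longleftrightarrow> even n" by simp
  ultimately show ?thesis by simp
qed

section \<open>From pairings back to sets of edges\<close>

text \<open>The quantifier over \<open>R\<close> lies inside, so that one \<open>M\<close> serves
  both colours.\<close>

lemma perfect_matching_of_pairing:
  assumes "verts P = mset_set V" and "finite V"
  shows "\<exists>M. finite M \<and> perfect_matching V ([V]\<^bsup>2\<^esup>) M \<and>
    (\<forall>R. card {e \<in> M. R e} = cnt (\<lambda>x y. R {x, y}) P)"
  using assms
proof (induction P arbitrary: V)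
  case empty
  then have "V = {}" by (metis mset_set_empty_iff verts_simps(1))
  then show ?case
    by (intro exI[of _ "{}"]) (auto simp: perfect_matching_def matching_def)
next
  case (add e P)
  obtain x y where e: "e = (x, y)" by (cases e)
  have xy: "x \<in> V" "y \<in> V" "x \<noteq> y"
    using pairing_edge[OF add.prems(1), of x y] e by auto
  define W where "W = V - {x, y}"
  have W: "V = insert x (insert y W)" "x \<notin> W" "y \<notin> W" "finite W"
    using xy add.prems(2) by (auto simp: W_def)
  have "mset_set V = {#x, y#} + mset_set W" using W xy(3) by simp
  then have "verts P = mset_set W" using add.prems(1) e by simp
  from add.IH[OF this W(4)] obtain M where M: "finite M" "perfect_matching W ([W]\<^bsup>2\<^esup>) M"
    "\<And>R. card {e \<in> M. R e} = cnt (\<lambda>x y. R {x, y}) P" by blast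
  have sub: "e \<subseteq> W" if "e \<in> M" for e
    using M(2) that by (auto simp: perfect_matching_def matching_def nsets_def)
  then have new: "{x, y} \<notin> M" using W(2) by blast
  have "[W]\<^bsup>2\<^esup> \<subseteq> [V]\<^bsup>2\<^esup>" using W(1) by (intro nsets_mono) auto
  moreover have "{x, y} \<in> [V]\<^bsup>2\<^esup>" using xy by (auto simp: nsets_def)
  moreover have "disjnt {x, y} e \<and> disjnt e {x, y}" if "e \<in> M" for e
    using sub[OF that] W(2,3) by (auto simp: disjnt_def)
  ultimately have "perfect_matching V ([V]\<^bsup>2\<^esup>) (insert {x, y} M)"
    using M(2) W(1)
    by (auto simp: perfect_matching_def matching_def pairwise_insert)
  moreover have "card {e \<in> insert {x, y} M. R e} = cnt (\<lambda>x y. R {x, y}) (add_mset e P)" for R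
  proof -
    have "{e \<in> insert {x, y} M. R e} =
      (if R {x, y} then insert {x, y} {e \<in> M. R e} else {e \<in> M. R e})" by auto
    then show ?thesis using new M(1) M(3)[of R] e by simp
  qed
  ultimately show ?case using M(1) by (intro exI[of _ "insert {x, y} M"]) blast
qed

section \<open>The critical switch and the parity contradiction\<close>

theorem theorem2:
  fixes n :: nat and V :: "'a set" and c :: "'a set \<Rightarrow> colour"
  assumes "n \<ge> 1"
    and "finite V" and "card V = 4 * n"
    and "card {e \<in> [V]\<^bsup>2\<^esup>. c e = Black} = card {e \<in> [V]\<^bsup>2\<^esup>. c e = Red}"
  shows "\<exists>M. perfect_matching V ([V]\<^bsup>2\<^esup>) M \<and>
           card {e \<in> M. c e = Black} = card {e \<in> M. c e = Red}"
proof -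
  define B where "B x y \<longleftrightarrow> c {x, y} = Black" for x y
  define R where "R x y \<longleftrightarrow> c {x, y} = Red" for x y
  have RB: "R x y \<longleftrightarrow> \<not> B x y" for x y
    by (cases "c {x, y}") (auto simp: R_def B_def)
  have sym: "symp B" "symp R" by (auto simp: symp_def B_def R_def insert_commute)
  have Bs: "B x y = B y x" for x y by (simp add: B_def insert_commute)
  have size: "size P = 2 * n" if "verts P = mset_set V" for P
    using size_verts[of P] that assms(3) by simp
  have cntR: "cnt R P + cnt B P = size P" for P
    using cnt_not[of B P] by (simp add: RB[abs_def])
  have edges: "card {e \<in> [V]\<^bsup>2\<^esup>. c e = Black} + card {e \<in> [V]\<^bsup>2\<^esup>. c e = Red} = 2 * n * (4 * n - 1)"
  proof -
    have "card {e \<in> [V]\<^bsup>2\<^esup>. c e = Black} + card {e \<in> [V]\<^bsup>2\<^esup>. c e = Red} =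
      card ({e \<in> [V]\<^bsup>2\<^esup>. c e = Black} \<union> {e \<in> [V]\<^bsup>2\<^esup>. c e = Red})"
      using assms(2) by (intro card_Un_disjoint[symmetric]) (auto simp: finite_imp_finite_nsets)
    also have "{e \<in> [V]\<^bsup>2\<^esup>. c e = Black} \<union> {e \<in> [V]\<^bsup>2\<^esup>. c e = Red} = [V]\<^bsup>2\<^esup>"
      by (auto intro: colour.exhaust)
    also have "card ([V]\<^bsup>2\<^esup>) = (4 * n) choose 2"
      by (simp add: card_nsets assms(3))
    also have "\<dots> = 2 * n * (4 * n - 1)" by (simp add: choose_two)
    finally show ?thesis .
  qed
  have half: "int (card {e \<in> [V]\<^bsup>2\<^esup>. c e = Black}) = int n * (4 * int n - 1)"
  proof -
    have "card {e \<in> [V]\<^bsup>2\<^esup>. c e = Black} = n * (4 * n - 1)" using edges assms(4) by simp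
    then show ?thesis using assms(1) by (simp add: of_nat_diff)
  qed
  have sumB: "(\<Sum>p\<in>V. \<Sum>q\<in>V. of_bool (p \<noteq> q \<and> B p q)) = 2 * int n * (4 * int n - 1)"
    using sum_ordered_pairs_eq_card_edges[OF assms(2), of "\<lambda>e. c e = Black"] half
    by (simp add: B_def)
  have sumR: "(\<Sum>p\<in>V. \<Sum>q\<in>V. of_bool (p \<noteq> q \<and> R p q)) = 2 * int n * (4 * int n - 1)"
    using sum_ordered_pairs_eq_card_edges[OF assms(2), of "\<lambda>e. c e = Red"] half assms(4)
    by (simp add: R_def)
  have "\<exists>P. verts P = mset_set V \<and> cnt B P = n"
  proof (rule ccontr)
    assume "\<not> ?thesis"
    then have none: "cnt B P \<noteq> n" if "verts P = mset_set V" for P using that by blast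
    \<comment> \<open>Stated for a general \<open>g\<close> because it is applied to both colours:
      at least \<open>n\<close> red edges means at most \<open>n\<close> black ones.\<close>
    have ge: "\<exists>P. verts P = mset_set V \<and> cnt g P \<ge> n"
      if g: "symp g" "(\<Sum>p\<in>V. \<Sum>q\<in>V. of_bool (p \<noteq> q \<and> g p q)) = 2 * int n * (4 * int n - 1)" for g
    proof -
      obtain P where P: "verts P = mset_set V"
        "2 * int n * (4 * int n - 1) \<le> 2 * (2 * int (2 * n) - 1) * int (cnt g P)"
        using exists_pairing_ge_average[OF g(1) assms(2), of "2 * n"] assms(3)
        unfolding g(2) by auto
      have "(2 * (4 * int n - 1)) * int n \<le> (2 * (4 * int n - 1)) * int (cnt g P)"
        using P(2) by (simp add: algebra_simps)
      then have "int n \<le> int (cnt g P)"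
        using assms(1) by (subst (asm) mult_le_cancel_left_pos) auto
      then show ?thesis using P(1) by auto
    qed
    obtain P1 where P1: "verts P1 = mset_set V" "cnt B P1 > n"
      using ge[OF sym(1) sumB] none by (metis le_neq_implies_less)
    obtain P2 where P2: "verts P2 = mset_set V" "cnt R P2 \<ge> n"
      using ge[OF sym(2) sumR] by blast
    define S where "S P \<longleftrightarrow> verts P = mset_set V \<and> cnt B P > n" for P
    have "\<not> S P2" using P2 cntR[of P2] size[OF P2(1)] by (simp add: S_def)
    then have "\<exists>a b x d N. S (add_mset (a, b) (add_mset (x, d) N)) \<and>
      \<not> S (add_mset (a, x) (add_mset (b, d) N))"
    proof (rule contrapos_np)
      assume "\<nexists>a b x d N. S (add_mset (a, b) (add_mset (x, d) N)) \<and>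
        \<not> S (add_mset (a, x) (add_mset (b, d) N))"
      moreover have "S P1" "verts P1 = verts P2" using P1 P2 by (simp_all add: S_def)
      moreover have "S (add_mset (b, a) N)" if "S (add_mset (a, b) N)" for a b N
        using that Bs[of a b] by (simp add: S_def add_mset_commute)
      ultimately show "S P2" using switch_induct[of S P1 P2] by blast
    qed
    then obtain a b x d N where
      S: "S (add_mset (a, b) (add_mset (x, d) N))" "\<not> S (add_mset (a, x) (add_mset (b, d) N))"
      by blast
    have V: "mset_set V = {#a, b, x, d#} + verts N"
      using S(1) by (simp add: S_def add_mset_commute)
    have less: "cnt B (add_mset (a, x) (add_mset (b, d) N)) < n"
      using S(2) none[of "add_mset (a, x) (add_mset (b, d) N)"] V
      by (auto simp: S_def add_mset_commute)
    have gr: "cnt B (add_mset (a, b) (add_mset (x, d) N)) > n" using S(1) by (simp add: S_def)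
    define k where "k = n - 1"
    have n: "n = Suc k" using assms(1) by (simp add: k_def)
    \<comment> \<open>A switch replaces two edges, so a drop from above \<open>n\<close> to below
      \<open>n\<close> can only go from \<open>n + 1\<close> to \<open>n - 1\<close>; this
      determines all four colours. The vertex \<open>x\<close> is the \<open>c\<close> of the
      overview, as \<open>c\<close> is now the colouring.\<close>
    have Q: "B a b" "B x d" "\<not> B a x" "\<not> B b d" and cntN: "cnt B N = k"
      using less gr n by (auto split: if_splits simp: of_bool_def)
    have sizeN: "size N = 2 * k" using size[of "add_mset (a, b) (add_mset (x, d) N)"] V n
      by (simp add: add_mset_commute)
    \<comment> \<open>If \<open>ad\<close> and \<open>bx\<close> had different colours, matching
      along them would give \<open>n\<close> black edges.\<close>
    have diag: "B a d = B b x"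
      using none[of "add_mset (a, d) (add_mset (b, x) N)"] V n cntN
      by (auto simp: add_mset_commute)
    show False
    proof (cases "B a d")
      case True
      obtain l where "\<forall>p\<in>V. \<forall>q\<in>V. p \<noteq> q \<longrightarrow> B p q = (l p \<noteq> (l q :: bool))"
        using cut_of_unbalanced_quad[OF sym(1) Q(1) _ Q(2) True Q(3,4) V cntN sizeN] none diag True n
        by auto
      then have "even (cnt B P) \<longleftrightarrow> even n" if "verts P = mset_set V" for P
        using balanced_cut_cnt[OF assms(2,3) _ sumB that, of l] by blast
      \<comment> \<open>This pairing has \<open>n + 1\<close> black edges, which is the wrong
        parity.\<close>
      from this[of "add_mset (a, b) (add_mset (x, d) N)"] show False
        using V Q cntN n by (simp add: add_mset_commute)
    next
      case False
      have V': "mset_set V = {#a, x, b, d#} + verts N" using V by (simp add: add_mset_commute)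
      \<comment> \<open>In the other case the red edges form the 4-cycle \<open>a x b d\<close> with
        black diagonals \<open>ab\<close> and \<open>xd\<close>, so the same argument runs with the
        colours exchanged.\<close>
      have RQ: "R a x" "R x b" "R b d" "R a d" "\<not> R a b" "\<not> R x d"
        using Q False diag Bs[of x b] by (auto simp: RB)
      have "cnt R N = k" using cntR[of N] cntN sizeN by simp
      moreover have "cnt R P \<noteq> Suc k" if "verts P = mset_set V" for P
        using none[OF that] cntR[of P] size[OF that] n by simp
      ultimately obtain l where "\<forall>p\<in>V. \<forall>q\<in>V. p \<noteq> q \<longrightarrow> R p q = (l p \<noteq> (l q :: bool))"
        using cut_of_unbalanced_quad[OF sym(2) RQ V' _ sizeN] by blast
      then have "even (cnt R P) \<longleftrightarrow> even n" if "verts P = mset_set V" for P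
        using balanced_cut_cnt[OF assms(2,3) _ sumR that, of l] by blast
      from this[of "add_mset (a, x) (add_mset (b, d) N)"] show False
        using V RQ \<open>cnt R N = k\<close> n by (simp add: add_mset_commute)
    qed
  qed
  then obtain P where P: "verts P = mset_set V" "cnt B P = n" by blast
  obtain M where M: "perfect_matching V ([V]\<^bsup>2\<^esup>) M"
    "\<And>R. card {e \<in> M. R e} = cnt (\<lambda>x y. R {x, y}) P"
    using perfect_matching_of_pairing[OF P(1) assms(2)] by blast
  have "card {e \<in> M. c e = Black} = cnt B P" "card {e \<in> M. c e = Red} = cnt R P"
    using M(2) by (simp_all add: B_def[abs_def] R_def[abs_def])
  then show ?thesis using M(1) P cntR[of P] size[OF P(1)] by auto
qed

end
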